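(* Let $G$ be a finite CA group of order $n=|G|$ with center of size $z$, and suppose there are exactly $j$ distinct centralizers of non-central elements of $G$, of sizes $c_1,\dots,c_j$. Then, up to a factor $\pm1$, the characteristic polynomial (in the variable $\lambda$) of the transition matrix of the commuting chain on $G$ is \[\lambda^{n-j-1}\left(\frac{z}{|G|}\left(1+\sum_{k=1}^{j}\frac{c_k-z}{c_k(\lambda-1)+z}\right)-\lambda\right)\prod_{i=1}^{j}\left(\lambda-\frac{c_i-z}{c_i}\right),\] the equality being understood as an identity of rational functions in $\lambda$.
   Context: For a finite group $G$ with center $Z$ and $x\in G$, let $C_x=\{h\in G: hx=xh\}$ be the centralizer of $x$. $G$ is a CA group if commutativity is a transitive relation on $G\setminus Z$ (equivalently, the centralizer of every non-central element is abelian). The commuting chain on $G$ is the Markov chain with state space $G$ and transition matrix $P(x,y)=\frac{1}{|C_x|}\mathbf 1_{\{xy=yx\}}$. *)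

theory Defs
  imports
    "HOL-Algebra.Group"
    "HOL-Computational_Algebra.Polynomial_Factorial"
    "Jordan_Normal_Form.Char_Poly"
begin

definition group_center :: "('a, 'b) monoid_scheme \<Rightarrow> 'a set" where
  "group_center G = {x \<in> carrier G. \<forall>h \<in> carrier G. h \<otimes>\<^bsub>G\<^esub> x = x \<otimes>\<^bsub>G\<^esub> h}"

definition centralizer :: "('a, 'b) monoid_scheme \<Rightarrow> 'a \<Rightarrow> 'a set" where
  "centralizer G x = {h \<in> carrier G. h \<otimes>\<^bsub>G\<^esub> x = x \<otimes>\<^bsub>G\<^esub> h}"

definition CA_group :: "('a, 'b) monoid_scheme \<Rightarrow> bool" where
  "CA_group G \<longleftrightarrow> group G \<and>
     transp_on (carrier G - group_center G) (\<lambda>x y. x \<otimes>\<^bsub>G\<^esub> y = y \<otimes>\<^bsub>G\<^esub> x)"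

definition commuting_chain :: "('a, 'b) monoid_scheme \<Rightarrow> 'a \<Rightarrow> 'a \<Rightarrow> real" where
  "commuting_chain G x y =
     1 / real (card (centralizer G x)) * of_bool (x \<otimes>\<^bsub>G\<^esub> y = y \<otimes>\<^bsub>G\<^esub> x)"

(* Matrices of Jordan_Normal_Form are indexed by 0, ..., n - 1, so the state space has to be
   listed as e 0, ..., e (n - 1). The characteristic polynomial does not depend on e. *)
definition commuting_matrix :: "('a, 'b) monoid_scheme \<Rightarrow> (nat \<Rightarrow> 'a) \<Rightarrow> real mat" where
  "commuting_matrix G e =
     mat (card (carrier G)) (card (carrier G)) (\<lambda>(r, s). commuting_chain G (e r) (e s))"

text \<open>The field of rational functions in one variable over the reals is \<^typ>\<open>real poly fract\<close>.\<close>

definition rf_const :: "real \<Rightarrow> real poly fract" where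
  "rf_const a = to_fract [:a:]"

definition rf_var :: "real poly fract" where
  "rf_var = to_fract [:0, 1:]"

end

theory Submission
  imports Defs
begin

text \<open>Lump the states of the chain by their centralizer: one class is the center and, by the CA
  property, the others are the sets \<open>C\<^sub>k - Z\<close>. The transition matrix factors as \<open>A B\<close> with \<open>A\<close> the
  incidence matrix of states and classes, so by Sylvester's identity its characteristic polynomial
  is \<open>\<lambda>\<^bsup>n-j-1\<^esup>\<close> times that of the \<open>(j + 1) \<times> (j + 1)\<close> matrix \<open>B A\<close>. The latter is an arrow matrix,
  because two distinct centralizers of non-central elements meet only in the center, and its
  determinant is a Schur complement. The sign is \<open>-1\<close> since \<open>char_poly\<close> is monic.\<close>

section \<open>Determinants\<close>

text \<open>A block column operation of determinant 1 subtracts \<open>B * X\<close> from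
  \<open>A\<close> and clears the lower left block. Giving that block as \<open>D * X\<close>
  expresses the Schur complement without inverting \<open>D\<close>, so an integral domain
  suffices.\<close>

lemma det_four_block_mat_lower_right:
  fixes A :: "'a :: idom mat"
  assumes A: "A \<in> carrier_mat n n" and B: "B \<in> carrier_mat n m"
    and X: "X \<in> carrier_mat m n" and D: "D \<in> carrier_mat m m"
  shows "det (four_block_mat A B (D * X) D) = det (A - B * X) * det D"
proof -
  let ?M = "four_block_mat A B (D * X) D"
  let ?N = "four_block_mat (1\<^sub>m n) (0\<^sub>m n m) (- X) (1\<^sub>m m)"
  have DX: "D * X \<in> carrier_mat m n" using D X by simp
  have mX: "- X \<in> carrier_mat m n" using X by simp
  have M: "?M \<in> carrier_mat (n + m) (n + m)" using A D by simp
  have N: "?N \<in> carrier_mat (n + m) (n + m)" by simp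
  have BX: "B * (- X) = - (B * X)" using B X by simp
  have DX': "D * (- X) = - (D * X)" using D X by simp
  have "det ?M = det ?M * det ?N"
    by (subst det_four_block_mat_upper_right_zero[of _ n _ m]) (use mX in auto)
  also have "\<dots> = det (?M * ?N)" by (rule det_mult[OF M N, symmetric])
  also have "?M * ?N = four_block_mat (A - B * X) B (0\<^sub>m m n) D"
    by (subst mult_four_block_mat[OF A B DX D _ _ mX])
       (use A B X D DX in \<open>auto simp: BX DX' minus_add_uminus_mat[of A n n]\<close>)
  also have "det \<dots> = det (A - B * X) * det D"
    by (rule det_four_block_mat_lower_left_zero) (use A B X D in auto)
  finally show ?thesis .
qed

text \<open>The mirror image: the same unitriangular matrix, now acting from the left as a row
  operation, eliminates with \<open>A\<close> as pivot block.\<close>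

lemma det_four_block_mat_upper_left:
  fixes A :: "'a :: idom mat"
  assumes A: "A \<in> carrier_mat n n" and B: "B \<in> carrier_mat n m"
    and X: "X \<in> carrier_mat m n" and D: "D \<in> carrier_mat m m"
  shows "det (four_block_mat A B (X * A) D) = det A * det (D - X * B)"
proof -
  let ?M = "four_block_mat A B (X * A) D"
  let ?N = "four_block_mat (1\<^sub>m n) (0\<^sub>m n m) (- X) (1\<^sub>m m)"
  have XA: "X * A \<in> carrier_mat m n" using A X by simp
  have mX: "- X \<in> carrier_mat m n" using X by simp
  have M: "?M \<in> carrier_mat (n + m) (n + m)" using A D by simp
  have N: "?N \<in> carrier_mat (n + m) (n + m)" by simp
  have XB: "(- X) * B = - (X * B)" using B X by simp
  have XA': "(- X) * A = - (X * A)" using A X by simp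
  have D': "- (X * B) + D = D - X * B"
    using B X D by (intro eq_matI) auto
  have "det ?M = det ?N * det ?M"
    by (subst det_four_block_mat_upper_right_zero[of _ n _ m]) (use mX in auto)
  also have "\<dots> = det (?N * ?M)" by (rule det_mult[OF N M, symmetric])
  also have "?N * ?M = four_block_mat A B (0\<^sub>m m n) (D - X * B)"
    by (subst mult_four_block_mat[OF _ _ mX _ A B XA D])
       (use A B X D XA in \<open>auto simp: XB XA' D' uminus_l_inv_mat\<close>)
  also have "det \<dots> = det A * det (D - X * B)"
    by (rule det_four_block_mat_lower_left_zero) (use A B X D in auto)
  finally show ?thesis .
qed

text \<open>Sylvester's identity: both sides are the determinant of the block matrix
  \<open>[[t I, A], [t B, t I]]\<close>.\<close>

lemma det_smult_one_minus_mult_commute: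
  fixes A :: "'a :: idom mat"
  assumes A: "A \<in> carrier_mat n m" and B: "B \<in> carrier_mat m n"
  shows "t ^ m * det (t \<cdot>\<^sub>m 1\<^sub>m n - A * B) = t ^ n * det (t \<cdot>\<^sub>m 1\<^sub>m m - B * A)"
proof -
  \<comment> \<open>Scalar matrices commute with \<open>B\<close>, so the lower left block has both
    shapes, \<open>D * X\<close> and \<open>X * A\<close>, that the two Schur complements ask
    for.\<close>
  have eq: "(t \<cdot>\<^sub>m 1\<^sub>m m) * B = B * (t \<cdot>\<^sub>m 1\<^sub>m n)"
    using B by (simp add: mult_smult_assoc_mat[of _ m m _ n] mult_smult_distrib[of _ m n _ n])
  have "det (four_block_mat (t \<cdot>\<^sub>m 1\<^sub>m n) A ((t \<cdot>\<^sub>m 1\<^sub>m m) * B) (t \<cdot>\<^sub>m 1\<^sub>m m))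
      = det (t \<cdot>\<^sub>m 1\<^sub>m n - A * B) * t ^ m"
    by (subst det_four_block_mat_lower_right[of _ n _ m]) (use A B in auto)
  moreover have "det (four_block_mat (t \<cdot>\<^sub>m 1\<^sub>m n) A (B * (t \<cdot>\<^sub>m 1\<^sub>m n)) (t \<cdot>\<^sub>m 1\<^sub>m m))
      = t ^ n * det (t \<cdot>\<^sub>m 1\<^sub>m m - B * A)"
    by (subst det_four_block_mat_upper_left[of _ n _ m]) (use A B in auto)
  ultimately show ?thesis unfolding eq by (simp add: mult.commute)
qed

text \<open>Sylvester's identity over the polynomial ring, with \<open>t\<close> the variable and
  both matrices lifted to constant polynomials. Powers on both sides avoid comparing
  \<open>n\<close> with \<open>m\<close>.\<close>

lemma char_poly_mult_commute:
  fixes A :: "'a :: idom mat"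
  assumes A: "A \<in> carrier_mat n m" and B: "B \<in> carrier_mat m n"
  shows "[:0, 1:] ^ m * char_poly (A * B) = [:0, 1:] ^ n * char_poly (B * A)"
proof -
  let ?l = "map_mat (\<lambda>a :: 'a. [:a:])"
  have chi: "char_poly (A * B) = det ([:0, 1:] \<cdot>\<^sub>m 1\<^sub>m n - ?l A * ?l B)"
    if "A \<in> carrier_mat n m" "B \<in> carrier_mat m n" for A B :: "'a mat" and n m
  proof -
    interpret coeff_lift_hom: comm_ring_hom "\<lambda>a :: 'a. [:a:]"
      by unfold_locales (auto simp: one_pCons)
    have "char_poly_matrix (A * B) = [:0, 1:] \<cdot>\<^sub>m 1\<^sub>m n - ?l (A * B)"
      unfolding char_poly_matrix_def by (rule eq_matI) (use that in auto)
    also have "?l (A * B) = ?l A * ?l B"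
      using that by (rule coeff_lift_hom.mat_hom_mult)
    finally show ?thesis by (simp add: char_poly_def)
  qed
  show ?thesis
    unfolding chi[OF A B] chi[OF B A]
    by (rule det_smult_one_minus_mult_commute) (use A B in auto)
qed

lemma det_mat_diag: "det (mat_diag n f) = (\<Prod>i<n. f i)"
proof -
  have "det (mat_diag n f) = prod_list (diag_mat (mat_diag n f))"
    by (rule det_upper_triangular[of _ n]) (auto simp: mat_diag_def)
  also have "diag_mat (mat_diag n f) = map f [0..<n]"
    by (auto simp: diag_mat_def mat_diag_def)
  also have "prod_list (map f [0..<n]) = (\<Prod>i<n. f i)"
    by (simp add: prod.list_conv_set_nth atLeast0LessThan)
  finally show ?thesis .
qed

text \<open>Schur complement with the lower right diagonal block as pivot; the complement is a
  single scalar.\<close>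

lemma det_arrow_mat:
  fixes M :: "'a :: field mat"
  assumes M: "M \<in> carrier_mat (Suc j) (Suc j)"
    and diag: "\<And>k. k \<in> {1..j} \<Longrightarrow> M $$ (k, k) \<noteq> 0"
    and off_diag: "\<And>k l. k \<in> {1..j} \<Longrightarrow> l \<in> {1..j} \<Longrightarrow> k \<noteq> l \<Longrightarrow> M $$ (k, l) = 0"
  shows "det M = (M $$ (0, 0) - (\<Sum>k = 1..j. M $$ (0, k) * M $$ (k, 0) / M $$ (k, k)))
    * (\<Prod>k = 1..j. M $$ (k, k))"
proof -
  let ?A = "mat 1 1 (\<lambda>_. M $$ (0, 0))"
  let ?B = "mat 1 j (\<lambda>(_, l). M $$ (0, Suc l))"
  \<comment> \<open>Dividing by the pivots makes \<open>?D * ?X\<close> the first column below the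
    corner.\<close>
  let ?X = "mat j 1 (\<lambda>(k, _). M $$ (Suc k, 0) / M $$ (Suc k, Suc k))"
  let ?D = "mat_diag j (\<lambda>k. M $$ (Suc k, Suc k))"
  have DX: "?D * ?X = mat j 1 (\<lambda>(k, _). M $$ (Suc k, 0))"
    by (subst mat_diag_mult_left[of _ j 1]) (use diag in auto)
  have M_eq: "M = four_block_mat ?A ?B (?D * ?X) ?D"
  proof (rule eq_matI)
    fix k l
    assume "k < dim_row (four_block_mat ?A ?B (?D * ?X) ?D)"
      and "l < dim_col (four_block_mat ?A ?B (?D * ?X) ?D)"
    then have "k \<le> j" "l \<le> j" by (auto simp: mat_diag_def)
    then show "M $$ (k, l) = four_block_mat ?A ?B (?D * ?X) ?D $$ (k, l)"
      unfolding DX by (cases k; cases l) (simp_all add: mat_diag_def off_diag)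
  qed (use M in \<open>auto simp: mat_diag_def\<close>)
  have "det (four_block_mat ?A ?B (?D * ?X) ?D) = det (?A - ?B * ?X) * det ?D"
    by (rule det_four_block_mat_lower_right) auto
  moreover have "det (?A - ?B * ?X)
      = M $$ (0, 0) - (\<Sum>k < j. M $$ (0, Suc k) * M $$ (Suc k, 0) / M $$ (Suc k, Suc k))"
    by (subst det_single) (auto simp: scalar_prod_def atLeast0LessThan)
  moreover have "det ?D = (\<Prod>k < j. M $$ (Suc k, Suc k))"
    by (rule det_mat_diag)
  ultimately have "det M =
      (M $$ (0, 0) - (\<Sum>k < j. M $$ (0, Suc k) * M $$ (Suc k, 0) / M $$ (Suc k, Suc k)))
        * (\<Prod>k < j. M $$ (Suc k, Suc k))"
    using arg_cong[OF M_eq, of det] by simp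
  then show ?thesis
    by (simp only: One_nat_def sum.atLeast1_atMost_eq prod.atLeast1_atMost_eq)
qed

section \<open>Rational functions\<close>

lemma rf_const_hom:
  "rf_const 0 = 0" "rf_const 1 = 1" "rf_const (a + b) = rf_const a + rf_const b"
  "rf_const (a - b) = rf_const a - rf_const b" "rf_const (- a) = - rf_const a"
  "rf_const (a * b) = rf_const a * rf_const b"
  by (simp_all add: rf_const_def flip: to_fract_add to_fract_diff to_fract_mult to_fract_uminus
        one_pCons)

lemma rf_const_eq_0_iff [simp]: "rf_const a = 0 \<longleftrightarrow> a = 0"
  by (simp add: rf_const_def)

lemma rf_const_divide:
  assumes "b \<noteq> 0"
  shows "rf_const (a / b) = rf_const a / rf_const b"
proof -
  have "rf_const (a / b) * rf_const b = rf_const a"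
    using assms by (simp flip: rf_const_hom)
  with assms show ?thesis by (simp add: field_simps)
qed

text \<open>Ensures that the diagonal pivots, variable minus constant, are nonzero.\<close>

lemma rf_var_neq_rf_const [simp]: "rf_var \<noteq> rf_const a"
  by (simp add: rf_var_def rf_const_def)

text \<open>Moves the determinant into a field, where the divisions of \<open>det_arrow_mat\<close>
  are available; ring homomorphisms commute with \<open>det\<close>.\<close>

lemma to_fract_char_poly:
  assumes "A \<in> carrier_mat n n"
  shows "to_fract (char_poly A)
    = det (mat n n (\<lambda>(k, l). (if k = l then rf_var else 0) - rf_const (A $$ (k, l))))"
proof -
  interpret to_fract_hom: comm_ring_hom "to_fract :: real poly \<Rightarrow> _"
    by unfold_locales auto
  have "det (map_mat to_fract (char_poly_matrix A))
      = det (mat n n (\<lambda>(k, l). (if k = l then rf_var else 0) - rf_const (A $$ (k, l))))"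
    unfolding char_poly_matrix_def
    by (intro arg_cong[of _ _ det] eq_matI)
       (use assms in \<open>auto simp: rf_var_def rf_const_def simp flip: to_fract_diff to_fract_uminus\<close>)
  then show ?thesis
    by (simp add: char_poly_def flip: to_fract_hom.hom_det)
qed

section \<open>Centralizers\<close>

lemma centralizer_eq_carrier_iff:
  assumes "x \<in> carrier G"
  shows "centralizer G x = carrier G \<longleftrightarrow> x \<in> group_center G"
  using assms by (auto simp: centralizer_def group_center_def)

lemma group_center_subset_centralizer:
  "x \<in> carrier G \<Longrightarrow> group_center G \<subseteq> centralizer G x"
  by (auto simp: centralizer_def group_center_def)

lemma mem_centralizer_self: "x \<in> carrier G \<Longrightarrow> x \<in> centralizer G x"
  by (simp add: centralizer_def)

text \<open>Since \<open>h\<close> and \<open>x\<close> commute, transitivity through either of them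
  shows that a non-central element commutes with both or with neither; central elements commute with
  both.\<close>

lemma CA_group_centralizer_eq:
  assumes CA: "CA_group G" and x: "x \<in> carrier G - group_center G"
    and h: "h \<in> centralizer G x - group_center G"
  shows "centralizer G h = centralizer G x"
proof -
  let ?R = "\<lambda>x y. x \<otimes>\<^bsub>G\<^esub> y = y \<otimes>\<^bsub>G\<^esub> x"
  have tr: "?R a c" if "a \<in> carrier G - group_center G" "b \<in> carrier G - group_center G"
      "c \<in> carrier G - group_center G" "?R a b" "?R b c" for a b c
    using CA that unfolding CA_group_def by (blast dest: transp_onD)
  have h': "h \<in> carrier G - group_center G" "?R h x"
    using h by (auto simp: centralizer_def)
  have "?R y h \<longleftrightarrow> ?R y x" if "y \<in> carrier G" for y
  proof (cases "y \<in> group_center G")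
    case True
    then show ?thesis using x h' by (auto simp: group_center_def)
  next
    case False
    with that have "y \<in> carrier G - group_center G" by simp
    then show ?thesis using tr[of y h x] tr[of y x h] x h' by auto
  qed
  then show ?thesis by (auto simp: centralizer_def)
qed

section \<open>The commuting chain\<close>

text \<open>Index \<open>0\<close> stands for the whole group, which is the centralizer of every central element.\<close>

locale CA_group_enum =
  fixes G :: "('a, 'b) monoid_scheme" and e :: "nat \<Rightarrow> 'a" and D :: "nat \<Rightarrow> 'a set" and j :: nat
  assumes finite_carrier: "finite (carrier G)"
    and CA: "CA_group G"
    and e: "bij_betw e {0..<card (carrier G)} (carrier G)"
    and D0: "D 0 = carrier G"
    and D: "bij_betw D {1..j} (centralizer G ` (carrier G - group_center G))"
begin

definition n where "n = card (carrier G)"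

definition block :: "nat \<Rightarrow> 'a set" where
  "block k = {x \<in> carrier G. centralizer G x = D k}"

text \<open>The factor \<open>A\<close> of the overview.\<close>

definition block_mat :: "real mat" where
  "block_mat = mat n (Suc j) (\<lambda>(r, k). of_bool (e r \<in> block k))"

text \<open>The factor \<open>B\<close> of the overview: row \<open>k\<close> is the uniform
  distribution on \<open>D k\<close>, which is the row of the transition matrix shared by all states
  in \<open>block k\<close>.\<close>

definition spread_mat :: "real mat" where
  "spread_mat = mat (Suc j) n (\<lambda>(k, s). of_bool (e s \<in> D k) / card (D k))"

section \<open>The centralizers and the partition of the group into blocks\<close>

lemma one_in_center: "\<one>\<^bsub>G\<^esub> \<in> group_center G"
proof -
  interpret group G using CA by (simp add: CA_group_def)
  show ?thesis by (auto simp: group_center_def)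
qed

lemma center_subset: "group_center G \<subseteq> carrier G"
  by (auto simp: group_center_def)

lemma finite_center: "finite (group_center G)"
  using center_subset finite_carrier by (rule finite_subset)

lemma D_pos:
  assumes "k \<in> {1..j}"
  obtains x where "x \<in> carrier G - group_center G" "D k = centralizer G x"
proof -
  have "D k \<in> centralizer G ` (carrier G - group_center G)"
    using assms bij_betw_apply[OF D] by simp
  then show thesis using that by blast
qed

text \<open>Treats index 0 like the others: the whole group is the centralizer of the
  identity.\<close>

lemma D_eq_centralizer:
  assumes "k \<le> j"
  obtains x where "x \<in> carrier G" "D k = centralizer G x"
proof (cases "k = 0")
  case True
  have "\<one>\<^bsub>G\<^esub> \<in> carrier G" using one_in_center center_subset by blast
  moreover from this have "D k = centralizer G \<one>\<^bsub>G\<^esub>"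
    using True D0 one_in_center centralizer_eq_carrier_iff[of "\<one>\<^bsub>G\<^esub>" G] by simp
  ultimately show thesis by (rule that)
next
  case False
  with assms have "k \<in> {1..j}" by simp
  then obtain x where "x \<in> carrier G" "D k = centralizer G x"
    using D_pos by (metis DiffD1)
  then show thesis by (rule that)
qed

lemma D_subset: "k \<le> j \<Longrightarrow> D k \<subseteq> carrier G"
  by (erule D_eq_centralizer) (auto simp: centralizer_def)

lemma finite_D: "k \<le> j \<Longrightarrow> finite (D k)"
  using D_subset finite_carrier finite_subset by blast

lemma center_subset_D: "k \<le> j \<Longrightarrow> group_center G \<subseteq> D k"
  by (erule D_eq_centralizer) (simp add: group_center_subset_centralizer)

lemma card_D_pos: "k \<le> j \<Longrightarrow> card (D k) > 0"
  using center_subset_D finite_D one_in_center by (fastforce simp: card_gt_0_iff)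

lemma D_neq_carrier: "k \<in> {1..j} \<Longrightarrow> D k \<noteq> carrier G"
  by (metis D_pos DiffE centralizer_eq_carrier_iff)

text \<open>Index 0 stays apart because a centralizer equal to the whole group belongs to a central
  element.\<close>

lemma D_inj: "inj_on D {..j}"
proof -
  have "{..j} = insert 0 {1..j}" by auto
  moreover have "D 0 \<notin> D ` {1..j}"
    using D_neq_carrier by (auto simp: D0 dest: sym)
  then have "inj_on D (insert 0 {1..j})"
    using bij_betw_imp_inj_on[OF D] by simp
  ultimately show ?thesis by simp
qed

lemma block_ex1:
  assumes "x \<in> carrier G"
  shows "\<exists>k\<le>j. centralizer G x = D k"
proof (cases "x \<in> group_center G")
  case True
  then show ?thesis using assms D0 centralizer_eq_carrier_iff by (metis le0)
next
  case False
  with assms have "centralizer G x \<in> D ` {1..j}"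
    using D by (simp add: bij_betw_def)
  then show ?thesis by auto
qed

lemma block_0: "block 0 = group_center G"
  using center_subset centralizer_eq_carrier_iff[of _ G] by (auto simp: block_def D0)

text \<open>The CA property enters here: every non-central element of \<open>D k\<close> has
  \<open>D k\<close> as its own centralizer. Conversely, an element lies in its own centralizer, and
  a central one has the whole group as centralizer.\<close>

lemma block_eq:
  assumes "k \<in> {1..j}"
  shows "block k = D k - group_center G"
proof -
  obtain x where x: "x \<in> carrier G - group_center G" "D k = centralizer G x"
    using assms by (rule D_pos)
  have "centralizer G h \<noteq> D k" if "h \<in> group_center G" for h
    using that center_subset centralizer_eq_carrier_iff[of h G] D_neq_carrier[OF assms] by auto
  moreover have "h \<in> D k" if "h \<in> carrier G" "centralizer G h = D k" for h
    using that mem_centralizer_self[of h G] by simp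
  moreover have "centralizer G h = D k" if "h \<in> D k - group_center G" for h
    using CA_group_centralizer_eq[OF CA x(1)] that x(2) by simp
  moreover have "D k \<subseteq> carrier G" using assms D_subset by simp
  ultimately show ?thesis by (auto simp: block_def)
qed

lemma block_disjoint: "k \<le> j \<Longrightarrow> l \<le> j \<Longrightarrow> k \<noteq> l \<Longrightarrow> block k \<inter> block l = {}"
  using D_inj by (auto simp: block_def inj_on_def)

lemma card_block:
  assumes "k \<in> {1..j}"
  shows "real (card (block k)) = real (card (D k)) - real (card (group_center G))"
proof -
  have "card (group_center G) \<le> card (D k)"
    using assms by (intro card_mono finite_D center_subset_D) auto
  then show ?thesis
    using assms by (simp add: block_eq card_Diff_subset finite_center center_subset_D of_nat_diff)
qed

text \<open>The identity is central, so fewer than \<open>n\<close> elements produce the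
  \<open>j\<close> centralizers. Hence \<open>n - j - 1\<close> is not a truncated
  subtraction.\<close>

lemma card_states: "j + 1 \<le> n"
proof -
  have "j = card (centralizer G ` (carrier G - group_center G))"
    using bij_betw_same_card[OF D] by simp
  also have "\<dots> \<le> card (carrier G - group_center G)"
    using finite_carrier by (intro card_image_le) auto
  also have "\<dots> < n"
    unfolding n_def using finite_carrier one_in_center center_subset
    by (intro psubset_card_mono) auto
  finally show ?thesis by simp
qed

section \<open>Factorization of the transition matrix and the lumped matrix\<close>

lemma commuting_matrix_eq: "commuting_matrix G e = block_mat * spread_mat"
proof (rule eq_matI)
  fix r s
  assume "r < dim_row (block_mat * spread_mat)" "s < dim_col (block_mat * spread_mat)"
  then have rs: "r < n" "s < n" by (auto simp: block_mat_def spread_mat_def)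
  then have er: "e r \<in> carrier G" and es: "e s \<in> carrier G"
    using e by (auto simp: n_def bij_betw_def)
  obtain k where k: "k \<le> j" "centralizer G (e r) = D k"
    using block_ex1[OF er] by blast
  \<comment> \<open>The state lies in exactly one block, so the sum in the matrix product collapses
    to row \<open>k\<close> of \<open>spread_mat\<close>.\<close>
  have iff: "e r \<in> block l \<longleftrightarrow> l = k" if "l \<le> j" for l
    using er k that D_inj by (auto simp: block_def inj_on_def)
  have "(block_mat * spread_mat) $$ (r, s)
      = (\<Sum>l<Suc j. of_bool (e r \<in> block l) * (of_bool (e s \<in> D l) / card (D l)))"
    using rs by (simp add: block_mat_def spread_mat_def scalar_prod_def atLeast0LessThan)
  also have "\<dots> = (\<Sum>l<Suc j. if l = k then of_bool (e s \<in> D l) / card (D l) else 0)"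
    by (rule sum.cong) (auto simp: iff)
  also have "\<dots> = of_bool (e s \<in> D k) / card (D k)"
    using k by simp
  also have "\<dots> = commuting_chain G (e r) (e s)"
    using es by (auto simp: commuting_chain_def k centralizer_def simp flip: k(2))
  finally show "commuting_matrix G e $$ (r, s) = (block_mat * spread_mat) $$ (r, s)"
    using rs by (simp add: commuting_matrix_def n_def)
qed (auto simp: commuting_matrix_def block_mat_def spread_mat_def n_def)

text \<open>The transition probability of the lumped chain: from class \<open>k\<close> the next
  state is uniform on \<open>D k\<close>.\<close>

lemma lumped_eq:
  assumes "k \<le> j" "l \<le> j"
  shows "(spread_mat * block_mat) $$ (k, l) = card (D k \<inter> block l) / card (D k)"
proof -
  have "(spread_mat * block_mat) $$ (k, l)
      = (\<Sum>s\<in>{0..<n}. of_bool (e s \<in> D k) / card (D k) * of_bool (e s \<in> block l))"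
    using assms by (simp add: block_mat_def spread_mat_def scalar_prod_def)
  also have "\<dots> = (\<Sum>x\<in>carrier G. of_bool (x \<in> D k) / card (D k) * of_bool (x \<in> block l))"
    by (rule sum.reindex_bij_betw) (use e in \<open>simp add: n_def\<close>)
  also have "\<dots> = (\<Sum>x\<in>carrier G. of_bool (x \<in> D k \<inter> block l)) / card (D k)"
    by (auto simp: sum_divide_distrib intro!: sum.cong)
  also have "(\<Sum>x\<in>carrier G. of_bool (x \<in> D k \<inter> block l)) = real (card (D k \<inter> block l))"
  proof -
    have "carrier G \<inter> (D k \<inter> block l) = D k \<inter> block l"
      using D_subset assms by (auto simp: block_def)
    then show ?thesis using finite_carrier by (simp add: sum_of_bool_eq flip: Int_def)
  qed
  finally show ?thesis .
qed

lemma lumped_entries: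
  fixes z :: real
  defines "Q \<equiv> spread_mat * block_mat" and "z \<equiv> real (card (group_center G))"
  shows "Q $$ (0, 0) = z / real n"
    and "k \<in> {1..j} \<Longrightarrow> Q $$ (0, k) = (real (card (D k)) - z) / real n"
    and "k \<in> {1..j} \<Longrightarrow> Q $$ (k, 0) = z / real (card (D k))"
    and "k \<in> {1..j} \<Longrightarrow> Q $$ (k, k) = (real (card (D k)) - z) / real (card (D k))"
    and "k \<in> {1..j} \<Longrightarrow> l \<in> {1..j} \<Longrightarrow> k \<noteq> l \<Longrightarrow> Q $$ (k, l) = 0"
proof -
  have D0_block: "D 0 \<inter> block l = block l" for l
    by (auto simp: D0 block_def)
  have block_sub: "D k \<inter> block k = block k" if "k \<in> {1..j}" for k
    using block_eq[OF that] by auto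
  show "Q $$ (0, 0) = z / real n"
    by (simp add: Q_def lumped_eq D0_block) (simp add: block_0 z_def D0 n_def)
  show "Q $$ (0, k) = (real (card (D k)) - z) / real n" if "k \<in> {1..j}"
    using that card_block[OF that] by (simp add: Q_def lumped_eq D0_block) (simp add: z_def D0 n_def)
  show "Q $$ (k, 0) = z / real (card (D k))" if "k \<in> {1..j}"
    using that center_subset_D[of k] by (simp add: Q_def lumped_eq block_0 Int_absorb1 z_def)
  show "Q $$ (k, k) = (real (card (D k)) - z) / real (card (D k))" if "k \<in> {1..j}"
    using that card_block[OF that] by (simp add: Q_def lumped_eq block_sub z_def)
  show "Q $$ (k, l) = 0" if "k \<in> {1..j}" "l \<in> {1..j}" "k \<noteq> l"
  proof -
    \<comment> \<open>\<open>block l\<close> omits the center, so only the part of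
      \<open>D k\<close> outside the center can meet it. This vanishing gives the arrow
      shape.\<close>
    have "D k \<inter> block l = block k \<inter> block l"
      using that by (auto simp: block_eq)
    also have "\<dots> = {}" using that by (intro block_disjoint) auto
    finally show ?thesis using that by (simp add: Q_def lumped_eq)
  qed
qed

section \<open>Characteristic polynomials of the lumped and the full matrix\<close>

lemma char_poly_lumped:
  fixes z :: real
  defines "z \<equiv> real (card (group_center G))"
  shows "to_fract (char_poly (spread_mat * block_mat)) =
    (rf_var - rf_const (z / real n) * (1 + (\<Sum>k = 1..j. rf_const (real (card (D k)) - z)
         / (rf_const (real (card (D k))) * (rf_var - 1) + rf_const z))))
    * (\<Prod>k = 1..j. rf_var - rf_const ((real (card (D k)) - z) / real (card (D k))))"
proof -
  let ?Q = "spread_mat * block_mat"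
  let ?M = "mat (Suc j) (Suc j)
    (\<lambda>(k, l). (if k = l then rf_var else 0) - rf_const (?Q $$ (k, l)))"
  note entries = lumped_entries[folded z_def]
  have "?Q \<in> carrier_mat (Suc j) (Suc j)"
    by (rule mult_carrier_mat[of _ _ n]) (simp_all add: spread_mat_def block_mat_def)
  then have "to_fract (char_poly ?Q) = det ?M"
    by (rule to_fract_char_poly)
  also have "\<dots> = (?M $$ (0, 0) - (\<Sum>k = 1..j. ?M $$ (0, k) * ?M $$ (k, 0) / ?M $$ (k, k)))
      * (\<Prod>k = 1..j. ?M $$ (k, k))"
    by (rule det_arrow_mat)
       (auto simp: entries rf_const_hom simp del: index_mult_mat)
  also have "(\<Prod>k = 1..j. ?M $$ (k, k))
      = (\<Prod>k = 1..j. rf_var - rf_const ((real (card (D k)) - z) / real (card (D k))))"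
    by (rule prod.cong) (auto simp: entries simp del: index_mult_mat)
  also have "?M $$ (0, 0) = rf_var - rf_const (z / real n)"
    by (simp add: entries del: index_mult_mat)
  also have "(\<Sum>k = 1..j. ?M $$ (0, k) * ?M $$ (k, 0) / ?M $$ (k, k))
      = (\<Sum>k = 1..j. rf_const (z / real n) * (rf_const (real (card (D k)) - z)
           / (rf_const (real (card (D k))) * (rf_var - 1) + rf_const z)))"
  proof (rule sum.cong)
    fix k assume k: "k \<in> {1..j}"
    let ?c = "real (card (D k))" and ?n = "real n"
    have c: "?c \<noteq> 0" using card_D_pos[of k] k by simp
    have n: "?n \<noteq> 0" using card_states by simp
    \<comment> \<open>The minus signs of the two off-diagonal entries cancel.\<close>
    have "?M $$ (0, k) * ?M $$ (k, 0) / ?M $$ (k, k)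
        = rf_const ((?c - z) / ?n) * rf_const (z / ?c) / (rf_var - rf_const ((?c - z) / ?c))"
      using k by (simp add: entries rf_const_hom del: index_mult_mat)
    \<comment> \<open>Moving \<open>?c\<close> from the second factor into the denominator prepares
      the form \<open>?c * (rf_var - 1) + z\<close> of the claim.\<close>
    also have "\<dots> = rf_const (z / ?n) * (rf_const (?c - z)
        / (rf_const ?c * (rf_var - rf_const ((?c - z) / ?c))))"
      using c n by (simp add: rf_const_divide mult_ac)
    also have "rf_const ?c * (rf_var - rf_const ((?c - z) / ?c))
        = rf_const ?c * (rf_var - 1) + rf_const z"
      using c by (subst right_diff_distrib) (simp add: rf_const_divide rf_const_hom(4) right_diff_distrib[of _ rf_var])
    finally show "?M $$ (0, k) * ?M $$ (k, 0) / ?M $$ (k, k)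
      = rf_const (z / ?n) * (rf_const (?c - z) / (rf_const ?c * (rf_var - 1) + rf_const z))" .
  qed simp
  also have "\<dots> = rf_const (z / real n) * (\<Sum>k = 1..j. rf_const (real (card (D k)) - z)
           / (rf_const (real (card (D k))) * (rf_var - 1) + rf_const z))"
    by (rule sum_distrib_left[symmetric])
  finally show ?thesis
    by (simp only: distrib_left mult_1_right diff_diff_eq)
qed

lemma char_poly_commuting_matrix:
  "to_fract (char_poly (commuting_matrix G e))
    = rf_var ^ (n - j - 1) * to_fract (char_poly (spread_mat * block_mat))"
proof -
  have "[:0, 1:] ^ Suc j * char_poly (commuting_matrix G e)
      = [:0, 1:] ^ n * char_poly (spread_mat * block_mat)"
    unfolding commuting_matrix_eq
    by (rule char_poly_mult_commute) (auto simp: block_mat_def spread_mat_def)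
  \<comment> \<open>By \<open>card_states\<close> the exponent splits, and the nonzero factor of
    degree \<open>Suc j\<close> can be cancelled.\<close>
  also have "[:0, 1:] ^ n = ([:0, 1:] ^ Suc j * [:0, 1:] ^ (n - j - 1) :: real poly)"
    using card_states by (simp flip: power_add power_Suc)
  finally have "char_poly (commuting_matrix G e)
      = [:0, 1:] ^ (n - j - 1) * char_poly (spread_mat * block_mat)"
    by (simp only: mult.assoc) simp
  moreover have "to_fract (p ^ m) = to_fract p ^ m" for p :: "real poly" and m
    by (induction m) auto
  ultimately show ?thesis by (simp add: rf_var_def)
qed

end

theorem theorem3p1:
  fixes G :: "('a, 'b) monoid_scheme" (structure)
    and e :: "nat \<Rightarrow> 'a"
    and C :: "nat \<Rightarrow> 'a set"
    and c :: "nat \<Rightarrow> nat"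
    and n z j :: nat
  assumes "finite (carrier G)"
    and "CA_group G"
    and "n = card (carrier G)"
    and "z = card (group_center G)"
    and "bij_betw C {1..j} (centralizer G ` (carrier G - group_center G))"
    and "\<And>k. k \<in> {1..j} \<Longrightarrow> c k = card (C k)"
    and "bij_betw e {0..<n} (carrier G)"
  shows "\<exists>s \<in> {1, -1}.
    to_fract (char_poly (commuting_matrix G e)) =
      s * (rf_var ^ (n - j - 1)
        * (rf_const (real z / real n)
             * (1 + (\<Sum>k = 1..j. rf_const (real (c k) - real z)
                      / (rf_const (real (c k)) * (rf_var - 1) + rf_const (real z))))
           - rf_var)
        * (\<Prod>i = 1..j. rf_var - rf_const ((real (c i) - real z) / real (c i))))"
proof -
  \<comment> \<open>Index 0 lies outside \<open>{1..j}\<close>, so this slot of \<open>C\<close> is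
    free to hold the class of central elements.\<close>
  define D where "D = C(0 := carrier G)"
  have "bij_betw D {1..j} (centralizer G ` (carrier G - group_center G))"
    using assms(5) by (rule iffD2[OF bij_betw_cong, rotated]) (simp add: D_def)
  then interpret CA_group_enum G e D j
    using assms(1,2,3,7) by unfold_locales (simp_all add: D_def)
  have n_eq: "CA_group_enum.n G = n"
    by (simp add: n_def assms(3))
  have c: "card (D k) = c k" if "k \<in> {1..j}" for k
    using that assms(6)[OF that] by (simp add: D_def)
  \<comment> \<open>Reverses the difference in the Schur complement to match the order in the claim;
    this produces the factor -1.\<close>
  have sign: "x * ((v - k) * p) = - 1 * (x * (k - v) * p)" for x v k p :: "real poly fract"
    by (simp add: algebra_simps)
  have "to_fract (char_poly (commuting_matrix G e)) = - 1 *
    (rf_var ^ (n - j - 1)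
        * (rf_const (real z / real n)
             * (1 + (\<Sum>k = 1..j. rf_const (real (card (D k)) - real z)
                      / (rf_const (real (card (D k))) * (rf_var - 1) + rf_const (real z))))
           - rf_var)
        * (\<Prod>i = 1..j. rf_var - rf_const ((real (card (D i)) - real z) / real (card (D i)))))"
    unfolding char_poly_commuting_matrix char_poly_lumped sign assms(4) n_eq ..
  also have "(\<Sum>k = 1..j. rf_const (real (card (D k)) - real z)
        / (rf_const (real (card (D k))) * (rf_var - 1) + rf_const (real z)))
      = (\<Sum>k = 1..j. rf_const (real (c k) - real z)
        / (rf_const (real (c k)) * (rf_var - 1) + rf_const (real z)))"
    by (rule sum.cong) (simp_all add: c)
  also have "(\<Prod>i = 1..j. rf_var - rf_const ((real (card (D i)) - real z) / real (card (D i))))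
      = (\<Prod>i = 1..j. rf_var - rf_const ((real (c i) - real z) / real (c i)))"
    by (rule prod.cong) (simp_all add: c)
  finally show ?thesis by blast
qed

end
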